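(* Let $\{\varphi_i\}_{i\in\Lambda}$ be a finite iterated function system of contracting similarities of $\mathbb{R}^d$ with similarity ratios $r_i\in(0,1)$, satisfying the open set condition, let $F$ be its limit set, let $p_i\in(0,1)$ with $\sum_{i\in\Lambda}p_i=1$, and let $\mu$ be the associated self-similar measure on $F$. If $\mu$ is doubling, then $$\dim_{\mathrm{A}}\mu=\max_{i\in\Lambda}\frac{\log p_i}{\log r_i},$$ and for $\mu$-almost every $x\in F$ we have $$\dim_{\mathrm{A}}(\mu,x)=\dim_{\mathrm{A}}\mu.$$
   Context: The limit set $F$ is the unique non-empty compact set with $F=\bigcup_{i\in\Lambda}\varphi_i(F)$. The self-similar measure $\mu$ is the unique Borel probability measure, fully supported on $F$, with $\mu=\sum_{i\in\Lambda}p_i\,\mu\circ\varphi_i^{-1}$. The open set condition (OSC) holds if there is a non-empty open set $U\subset\mathbb{R}^d$ with $\varphi_i(U)\subset U$ for all $i\in\Lambda$ and $\varphi_i(U)\cap\varphi_j(U)=\emptyset$ for $i\ne j$. All balls $B(x,r)$ are closed, with center $x\in F$. The measure $\mu$ is doubling if there is $C\ge1$ with $\mu(B(x,2r))\le C\mu(B(x,r))$ for all $x\in F$, $r>0$. The (global) Assouad dimension of $\mu$ is $$\dim_{\mathrm{A}}\mu=\inf\Big\{s>0:\exists C>0 \text{ such that for all } x\in F,\ 0<r<R,\ \tfrac{\mu(B(x,R))}{\mu(B(x,r))}\le C\big(\tfrac{R}{r}\big)^s\Big\},$$ and the pointwise Assouad dimension of $\mu$ at $x\in F$ is $$\dim_{\mathrm{A}}(\mu,x)=\inf\Big\{s>0:\exists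 C(x)>0 \text{ such that for all } 0<r<R,\ \tfrac{\mu(B(x,R))}{\mu(B(x,r))}\le C(x)\big(\tfrac{R}{r}\big)^s\Big\}.$$ *)

theory Defs
  imports "HOL-Probability.Probability"
begin

definition contracting_similarity :: "('a::metric_space \<Rightarrow> 'a) \<Rightarrow> real \<Rightarrow> bool" where
  "contracting_similarity f c \<longleftrightarrow> 0 < c \<and> c < 1 \<and> (\<forall>x y. dist (f x) (f y) = c * dist x y)"

definition open_set_condition :: "'i set \<Rightarrow> ('i \<Rightarrow> 'a::topological_space \<Rightarrow> 'a) \<Rightarrow> bool" where
  "open_set_condition \<Lambda> \<phi> \<longleftrightarrow>
     (\<exists>U. open U \<and> U \<noteq> {} \<and> (\<forall>i\<in>\<Lambda>. \<phi> i ` U \<subseteq> U) \<and>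
          (\<forall>i\<in>\<Lambda>. \<forall>j\<in>\<Lambda>. i \<noteq> j \<longrightarrow> \<phi> i ` U \<inter> \<phi> j ` U = {}))"

definition is_limit_set ::
    "'i set \<Rightarrow> ('i \<Rightarrow> 'a::topological_space \<Rightarrow> 'a) \<Rightarrow> 'a set \<Rightarrow> bool" where
  "is_limit_set \<Lambda> \<phi> F \<longleftrightarrow> compact F \<and> F \<noteq> {} \<and> F = (\<Union>i\<in>\<Lambda>. \<phi> i ` F)"

definition measure_support :: "'a::topological_space measure \<Rightarrow> 'a set" where
  "measure_support \<mu> = {x. \<forall>U. open U \<longrightarrow> x \<in> U \<longrightarrow> emeasure \<mu> U > 0}"

definition is_self_similar_measure ::
    "'i set \<Rightarrow> ('i \<Rightarrow> 'a::topological_space \<Rightarrow> 'a) \<Rightarrow> ('i \<Rightarrow> real) \<Rightarrow> 'a set \<Rightarrow> 'a measure \<Rightarrow> bool" where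
  "is_self_similar_measure \<Lambda> \<phi> p F \<mu> \<longleftrightarrow>
     prob_space \<mu> \<and> sets \<mu> = sets borel \<and> measure_support \<mu> = F \<and>
     (\<forall>A\<in>sets borel. emeasure \<mu> A = (\<Sum>i\<in>\<Lambda>. ennreal (p i) * emeasure (distr \<mu> borel (\<phi> i)) A))"

definition doubling_on :: "'a::metric_space set \<Rightarrow> 'a measure \<Rightarrow> bool" where
  "doubling_on F \<mu> \<longleftrightarrow>
     (\<exists>C\<ge>1. \<forall>x\<in>F. \<forall>r>0. measure \<mu> (cball x (2 * r)) \<le> C * measure \<mu> (cball x r))"

text \<open>
  Both dimensions are extended reals, so that the infimum of the empty set is \<open>\<infinity>\<close>.
  They are meant for \<open>F\<close> the support of \<open>\<mu>\<close> and points of \<open>F\<close>, where the denominators are positive.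
\<close>

definition assouad_dim :: "'a::metric_space set \<Rightarrow> 'a measure \<Rightarrow> ereal" where
  "assouad_dim F \<mu> =
     Inf (ereal ` {s. s > 0 \<and> (\<exists>C>0. \<forall>x\<in>F. \<forall>r R. 0 < r \<and> r < R \<longrightarrow>
        measure \<mu> (cball x R) / measure \<mu> (cball x r) \<le> C * (R / r) powr s)})"

definition pointwise_assouad_dim :: "'a::metric_space measure \<Rightarrow> 'a \<Rightarrow> ereal" where
  "pointwise_assouad_dim \<mu> x =
     Inf (ereal ` {s. s > 0 \<and> (\<exists>C>0. \<forall>r R. 0 < r \<and> r < R \<longrightarrow>
        measure \<mu> (cball x R) / measure \<mu> (cball x r) \<le> C * (R / r) powr s)})"

end

theory Submission
  imports Defs
begin

text \<open>
  Doubling together with the open set condition makes the measure of a ball of radius comparable to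
  \<open>r\<^sub>u = r\<^sub>i\<^sub>1 \<dots> r\<^sub>i\<^sub>k\<close> around a point of \<open>\<phi>\<^sub>u(F)\<close> comparable to \<open>p\<^sub>u\<close>. Indeed, every cylinder
  \<open>\<phi>\<^sub>u(F)\<close> contains a point having a ball of radius \<open>\<epsilon> r\<^sub>u\<close> which is charged only by cylinders inside
  \<open>\<phi>\<^sub>u(F)\<close>, and doubling carries the bound \<open>p\<^sub>u\<close> for this ball over to all the others.
  Ratios of measures of concentric balls thus compare with \<open>1 / p\<^sub>v\<close> where \<open>R / r\<close> compares with
  \<open>1 / r\<^sub>v\<close>, which gives the upper bound. For the lower bound, almost every point lies, for each \<open>n\<close>,
  in some cylinder \<open>\<phi>\<^sub>u\<phi>\<^sub>i\<^sup>n(F)\<close>, where \<open>i\<close> is a letter attaining the maximum.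
\<close>

section \<open>Similarities and packing in Euclidean space\<close>

text \<open>After translation and division by \<open>c\<close> the map becomes an isometry fixing 0,
  hence an orthogonal transformation, and these are onto in finite dimension.\<close>

lemma similarity_surj:
  fixes f :: "'a::euclidean_space \<Rightarrow> 'a"
  assumes "0 < c" and f: "\<And>x y. dist (f x) (f y) = c * dist x y"
  shows "surj f"
proof -
  define g where "g x = (f x - f 0) /\<^sub>R c" for x
  have "dist (g x) (g y) = dist x y" for x y
  proof -
    have "g x - g y = (f x - f y) /\<^sub>R c"
      by (simp add: g_def algebra_simps)
    then show ?thesis
      using assms f[of x y] by (simp add: dist_norm)
  qed
  moreover have "g 0 = 0"
    by (simp add: g_def)
  ultimately have "orthogonal_transformation g"
    by (simp add: orthogonal_transformation_isometry)
  then have "surj g"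
    by (rule orthogonal_transformation_surj)
  have "\<exists>x. y = f x" for y
  proof -
    obtain x where "g x = (y - f 0) /\<^sub>R c"
      using \<open>surj g\<close> by (metis surjD)
    then have "f x = y"
      using \<open>0 < c\<close> by (simp add: g_def)
    then show ?thesis
      by blast
  qed
  then show ?thesis
    by (simp add: surj_def)
qed

lemma similarity_image_ball:
  fixes f :: "'a::euclidean_space \<Rightarrow> 'a"
  assumes "0 < c" and f: "\<And>x y. dist (f x) (f y) = c * dist x y"
  shows "f ` ball x \<rho> = ball (f x) (c * \<rho>)"
proof (intro set_eqI iffI)
  fix y assume "y \<in> ball (f x) (c * \<rho>)"
  moreover obtain z where "y = f z"
    using similarity_surj[of c f] assms by blast
  ultimately show "y \<in> f ` ball x \<rho>"
    using \<open>0 < c\<close> by (auto simp: f)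
qed (use \<open>0 < c\<close> in \<open>auto simp: f\<close>)

lemma dist_centres_ge_of_disjoint_balls:
  fixes a b :: "'a::metric_space"
  assumes "ball a \<epsilon> \<inter> ball b \<delta> = {}" and "0 < \<delta>"
  shows "\<epsilon> \<le> dist a b"
  using assms by (metis centre_in_ball disjoint_iff linorder_not_less mem_ball)

text \<open>Rescaling by \<open>1 / t\<close> moves the points into the fixed ball
  \<open>cball 0 K\<close>, so one finite cover by balls of radius \<open>\<delta> / 2\<close>
  serves all \<open>x\<close> and \<open>t\<close>. By separation no cover ball receives two
  indices. A family is used instead of a set of points because words are to be counted
  later.\<close>

lemma packing_bound:
  fixes K \<delta> :: real
  assumes "0 < \<delta>"
  shows "\<exists>N::nat. \<forall>(I :: 'b set) f (x :: 'a::euclidean_space) t. 0 < t \<longrightarrow> f ` I \<subseteq> cball x (K * t) \<longrightarrow>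
      (\<forall>i\<in>I. \<forall>j\<in>I. i \<noteq> j \<longrightarrow> \<delta> * t \<le> dist (f i) (f j)) \<longrightarrow> card I \<le> N"
proof -
  obtain T :: "'a set" where T: "finite T" "cball 0 K \<subseteq> (\<Union>a\<in>T. ball a (\<delta> / 2))"
  proof (rule compactE_image[OF compact_cball, of UNIV "\<lambda>a. ball a (\<delta> / 2)" "0::'a" K])
    show "cball 0 K \<subseteq> (\<Union>a::'a. ball a (\<delta> / 2))"
      using \<open>0 < \<delta>\<close> by (meson UN_I UNIV_I centre_in_ball half_gt_zero subsetI)
  qed auto
  have "card I \<le> card T"
    if t: "0 < t" and I: "f ` I \<subseteq> cball x (K * t)"
      and sep: "\<forall>i\<in>I. \<forall>j\<in>I. i \<noteq> j \<longrightarrow> \<delta> * t \<le> dist (f i) (f j)"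
    for I :: "'b set" and f and x :: 'a and t
  proof -
    define g where "g i = (f i - x) /\<^sub>R t" for i
    have gd: "dist (g i) (g j) = dist (f i) (f j) / t" for i j
    proof -
      have "g i - g j = (f i - f j) /\<^sub>R t"
        by (simp add: g_def algebra_simps)
      then show ?thesis
        using t by (simp add: dist_norm divide_inverse_commute)
    qed
    have "\<exists>a\<in>T. dist a (g i) < \<delta> / 2" if "i \<in> I" for i
    proof -
      have "norm (f i - x) \<le> K * t"
        using I that by (auto simp: image_subset_iff dist_norm norm_minus_commute)
      then have "g i \<in> cball 0 K"
        using t by (simp add: g_def divide_inverse_commute[symmetric] pos_divide_le_eq)
      then have "g i \<in> (\<Union>a\<in>T. ball a (\<delta> / 2))"
        using T(2) by blast
      then show ?thesis
        by simp
    qed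
    then obtain h where h: "\<And>i. i \<in> I \<Longrightarrow> h i \<in> T \<and> dist (h i) (g i) < \<delta> / 2"
      by metis
    have "inj_on h I"
    proof (rule inj_onI, rule ccontr)
      fix i j assume ij: "i \<in> I" "j \<in> I" "h i = h j" "i \<noteq> j"
      have "dist (g i) (g j) < \<delta>"
        using h[OF ij(1)] h[OF ij(2)] ij(3) dist_triangle2[of "g i" "g j" "h i"]
        by (simp add: dist_commute)
      then show False
        using sep[rule_format, OF ij(1,2,4)] t by (simp add: gd field_simps)
    qed
    moreover have "h ` I \<subseteq> T"
      using h by auto
    ultimately show ?thesis
      using T(1) by (rule card_inj_on_le)
  qed
  then show ?thesis
    by (intro exI allI impI)
qed

text \<open>The complement of the support is the union of all open null sets, and Lindelof reduces
  this union to a countable one.\<close>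

lemma measure_Compl_measure_support:
  fixes \<mu> :: "'a::second_countable_topology measure"
  assumes "sets \<mu> = sets borel"
  shows "emeasure \<mu> (- measure_support \<mu>) = 0"
proof -
  define N where "N = {U. open U \<and> emeasure \<mu> U = 0}"
  obtain N' where N': "N' \<subseteq> N" "countable N'" "\<Union>N' = \<Union>N"
    using Lindelof[of N] by (auto simp: N_def)
  have "(\<Union>U\<in>N'. U) \<in> null_sets \<mu>"
    using N' assms by (intro null_sets_UN') (auto simp: N_def null_sets_def)
  moreover have "- measure_support \<mu> = \<Union>N"
    by (auto simp: measure_support_def N_def)
  ultimately show ?thesis
    using N' by (auto simp: null_sets_def)
qed

section \<open>Words and cut sets\<close>

locale self_similar_system =
  fixes \<Lambda> :: "'i set"
    and \<phi> :: "'i \<Rightarrow> 'a::euclidean_space \<Rightarrow> 'a"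
    and r p :: "'i \<Rightarrow> real"
    and F :: "'a set"
    and \<mu> :: "'a measure"
  assumes finite_letters: "finite \<Lambda>"
    and similarity: "\<And>i. i \<in> \<Lambda> \<Longrightarrow> contracting_similarity (\<phi> i) (r i)"
    and limit_set: "is_limit_set \<Lambda> \<phi> F"
    and p_bounds: "\<And>i. i \<in> \<Lambda> \<Longrightarrow> 0 < p i \<and> p i < 1"
    and sum_p: "(\<Sum>i\<in>\<Lambda>. p i) = 1"
    and self_similar: "is_self_similar_measure \<Lambda> \<phi> p F \<mu>"
begin

definition ratio :: "'i list \<Rightarrow> real" where
  "ratio w = prod_list (map r w)"

definition weight :: "'i list \<Rightarrow> real" where
  "weight w = prod_list (map p w)"

text \<open>Words stopped when their ratio first drops to \<open>t\<close> or below. Ratios decrease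
  along prefixes, so testing the longest proper prefix suffices; the empty word has none and is
  accepted exactly when \<open>1 \<le> t\<close>.\<close>

definition cut :: "real \<Rightarrow> 'i list set" where
  "cut t = {w \<in> lists \<Lambda>. ratio w \<le> t \<and> (w = [] \<or> t < ratio (butlast w))}"

lemma ratio_simps [simp]:
  "ratio [] = 1" "ratio (i # w) = r i * ratio w" "ratio (v @ w) = ratio v * ratio w"
  by (auto simp: ratio_def)

lemma weight_simps [simp]:
  "weight [] = 1" "weight (i # w) = p i * weight w" "weight (v @ w) = weight v * weight w"
  by (auto simp: weight_def)

lemma r_bounds: "i \<in> \<Lambda> \<Longrightarrow> 0 < r i \<and> r i < 1"
  using similarity by (auto simp: contracting_similarity_def)

lemma dist_\<phi>: "i \<in> \<Lambda> \<Longrightarrow> dist (\<phi> i x) (\<phi> i y) = r i * dist x y"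
  using similarity by (auto simp: contracting_similarity_def)

lemma letters_nonempty: "\<Lambda> \<noteq> {}"
  using sum_p by auto

lemma ratio_pos: "w \<in> lists \<Lambda> \<Longrightarrow> 0 < ratio w"
  by (induction w) (auto simp: r_bounds)

lemma ratio_le_1: "w \<in> lists \<Lambda> \<Longrightarrow> ratio w \<le> 1"
proof (induction w)
  case (Cons i w)
  then show ?case
    using r_bounds[of i] ratio_pos[of w] by (auto intro!: mult_le_one)
qed simp

lemma weight_pos: "w \<in> lists \<Lambda> \<Longrightarrow> 0 < weight w"
  by (induction w) (auto simp: p_bounds)

lemma dist_word: "w \<in> lists \<Lambda> \<Longrightarrow> dist (foldr \<phi> w x) (foldr \<phi> w y) = ratio w * dist x y"
  by (induction w) (auto simp: dist_\<phi>)

lemma continuous_word: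
  assumes "w \<in> lists \<Lambda>"
  shows "continuous_on S (foldr \<phi> w)"
proof (rule lipschitz_on_continuous_on)
  show "(ratio w)-lipschitz_on S (foldr \<phi> w)"
    using assms by (intro lipschitz_onI) (auto simp: dist_word ratio_pos less_imp_le)
qed

lemma inj_word: "w \<in> lists \<Lambda> \<Longrightarrow> inj (foldr \<phi> w)"
  by (rule injI) (metis dist_word dist_eq_0_iff mult_eq_0_iff ratio_pos less_irrefl)

lemma continuous_\<phi>: "i \<in> \<Lambda> \<Longrightarrow> continuous_on S (\<phi> i)"
  using continuous_word[of "[i]" S] by (simp add: comp_def id_def eta_contract_eq)

lemma word_vimage_borel:
  assumes "w \<in> lists \<Lambda>" and "A \<in> sets borel"
  shows "foldr \<phi> w -` A \<in> sets borel"
  using measurable_sets[OF borel_measurable_continuous_onI[OF continuous_word[OF assms(1)]] assms(2)]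
  by simp

lemma \<phi>_vimage_borel:
  assumes "i \<in> \<Lambda>" and "A \<in> sets borel"
  shows "\<phi> i -` A \<in> sets borel"
  using word_vimage_borel[of "[i]" A] assms by simp

lemma compact_F: "compact F"
  using limit_set unfolding is_limit_set_def by blast

lemma F_eq: "F = (\<Union>i\<in>\<Lambda>. \<phi> i ` F)"
  using limit_set unfolding is_limit_set_def by blast

lemma word_in_F: "w \<in> lists \<Lambda> \<Longrightarrow> x \<in> F \<Longrightarrow> foldr \<phi> w x \<in> F"
proof (induction w)
  case (Cons i w)
  then show ?case
    using F_eq by auto
qed auto

section \<open>Support and self-similarity of the measure\<close>

sublocale prob_space \<mu>
  using self_similar by (simp add: is_self_similar_measure_def)

lemma sets_\<mu> [simp, measurable_cong]: "sets \<mu> = sets borel"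
  using self_similar by (simp add: is_self_similar_measure_def)

lemma space_\<mu> [simp]: "space \<mu> = UNIV"
  using sets_eq_imp_space_eq[OF sets_\<mu>] by simp

lemma F_borel: "F \<in> sets borel"
  using compact_F by (rule borel_compact)

lemma measure_disjoint_F:
  assumes "A \<inter> F = {}"
  shows "measure \<mu> A = 0"
proof -
  have "emeasure \<mu> (- F) = 0"
    using measure_Compl_measure_support[OF sets_\<mu>] self_similar
    by (simp add: is_self_similar_measure_def)
  moreover have "emeasure \<mu> A \<le> emeasure \<mu> (- F)"
    using assms F_borel by (intro emeasure_mono) auto
  ultimately show ?thesis
    by (simp add: measure_def)
qed

lemma measure_superset_F:
  assumes "F \<subseteq> A" and "A \<in> sets borel"
  shows "measure \<mu> A = 1"
  using measure_disjoint_F[of "- A"] prob_compl[of A] assms by (auto simp: Compl_eq_Diff_UNIV)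

lemma measure_eq_sum:
  assumes "A \<in> sets borel"
  shows "measure \<mu> A = (\<Sum>i\<in>\<Lambda>. p i * measure \<mu> (\<phi> i -` A))"
proof -
  have "emeasure \<mu> A = (\<Sum>i\<in>\<Lambda>. ennreal (p i) * emeasure (distr \<mu> borel (\<phi> i)) A)"
    using self_similar assms by (simp add: is_self_similar_measure_def)
  also have "\<dots> = (\<Sum>i\<in>\<Lambda>. ennreal (p i * measure \<mu> (\<phi> i -` A)))"
  proof (rule sum.cong[OF refl])
    fix i assume i: "i \<in> \<Lambda>"
    have "\<phi> i \<in> measurable \<mu> borel"
      using borel_measurable_continuous_onI[OF continuous_\<phi>[OF i]]
        measurable_cong_sets[OF sets_\<mu> refl] by blast
    then have "emeasure (distr \<mu> borel (\<phi> i)) A = emeasure \<mu> (\<phi> i -` A)"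
      using assms by (simp add: emeasure_distr)
    then show "ennreal (p i) * emeasure (distr \<mu> borel (\<phi> i)) A = ennreal (p i * measure \<mu> (\<phi> i -` A))"
      using p_bounds[OF i] by (simp add: emeasure_eq_measure ennreal_mult)
  qed
  also have "\<dots> = ennreal (\<Sum>i\<in>\<Lambda>. p i * measure \<mu> (\<phi> i -` A))"
    using p_bounds by (intro sum_ennreal) (simp add: less_imp_le)
  finally show ?thesis
    using p_bounds by (simp add: emeasure_eq_measure sum_nonneg less_imp_le)
qed

text \<open>Of the self-similarity identity only the summand of the first letter is kept, one letter
  after the other.\<close>

lemma measure_ge_weight:
  assumes "w \<in> lists \<Lambda>" and "A \<in> sets borel"
  shows "weight w * measure \<mu> (foldr \<phi> w -` A) \<le> measure \<mu> A"
  using assms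
proof (induction w arbitrary: A rule: list.induct)
  case (Cons i w)
  have i: "i \<in> \<Lambda>"
    using Cons.prems by simp
  have "weight w * measure \<mu> (foldr \<phi> w -` (\<phi> i -` A)) \<le> measure \<mu> (\<phi> i -` A)"
    using Cons.prems by (intro Cons.IH \<phi>_vimage_borel) auto
  then have "weight (i # w) * measure \<mu> (foldr \<phi> (i # w) -` A) \<le> p i * measure \<mu> (\<phi> i -` A)"
    using p_bounds[OF i] by (simp add: vimage_comp mult.assoc)
  also have "\<dots> \<le> measure \<mu> A"
    unfolding measure_eq_sum[OF Cons.prems(2)]
    using p_bounds i by (intro member_le_sum) (auto simp: less_imp_le finite_letters)
  finally show ?case .
qed (simp add: id_def vimage_def)

lemma weight_le_measure:
  assumes "w \<in> lists \<Lambda>" and "A \<in> sets borel" and "foldr \<phi> w ` F \<subseteq> A"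
  shows "weight w \<le> measure \<mu> A"
  using measure_ge_weight[OF assms(1,2)] measure_superset_F[of "foldr \<phi> w -` A"]
    word_vimage_borel[OF assms(1,2)] assms(3)
  by (auto simp: image_subset_iff_subset_vimage)

section \<open>Cut sets: recursion, covering and disjointness\<close>

lemma cut_lists: "cut t \<subseteq> lists \<Lambda>"
  by (auto simp: cut_def)

lemma cut_ge_1: "1 \<le> t \<Longrightarrow> cut t = {[]}"
proof -
  assume t: "1 \<le> t"
  have "w = []" if "w \<in> cut t" for w
  proof (rule ccontr)
    assume "w \<noteq> []"
    then have "t < ratio (butlast w)" "butlast w \<in> lists \<Lambda>"
      using that by (auto simp: cut_def dest: in_set_butlastD)
    then show False
      using t ratio_le_1[of "butlast w"] by simp
  qed
  then show ?thesis
    using t by (auto simp: cut_def)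
qed

text \<open>Once the first letter \<open>i\<close> is removed, stopping at \<open>t\<close> becomes
  stopping at \<open>t / r i\<close>. For \<open>t < 1\<close> the empty word is not yet stopped, so
  a first letter exists.\<close>

lemma cut_less_1:
  assumes "t < 1"
  shows "cut t = (\<Union>i\<in>\<Lambda>. (#) i ` cut (t / r i))"
proof -
  have "w \<in> cut t \<longleftrightarrow> w \<in> (\<Union>i\<in>\<Lambda>. (#) i ` cut (t / r i))" for w
  proof (cases w)
    case Nil
    then show ?thesis
      using assms by (auto simp: cut_def)
  next
    case (Cons i v)
    have "i # v \<in> cut t \<longleftrightarrow> v \<in> cut (t / r i)" if "i \<in> \<Lambda>"
      using that assms r_bounds[OF that] by (auto simp: cut_def field_simps)
    moreover have "i # v \<in> cut t \<Longrightarrow> i \<in> \<Lambda>"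
      by (auto simp: cut_def)
    ultimately show ?thesis
      by (auto simp: Cons)
  qed
  then show ?thesis
    by blast
qed

definition rmax :: real where "rmax = Max (r ` \<Lambda>)"

definition rmin :: real where "rmin = Min (r ` \<Lambda>)"

lemma r_le_rmax: "i \<in> \<Lambda> \<Longrightarrow> r i \<le> rmax" and rmin_le_r: "i \<in> \<Lambda> \<Longrightarrow> rmin \<le> r i"
  by (auto simp: rmax_def rmin_def finite_letters)

lemma rmax_bounds: "0 < rmax" "rmax < 1" and rmin_bounds: "0 < rmin" "rmin < 1"
proof -
  have "rmax \<in> r ` \<Lambda>" "rmin \<in> r ` \<Lambda>"
    using letters_nonempty finite_letters by (auto simp: rmax_def rmin_def)
  then show "0 < rmax" "rmax < 1" "0 < rmin" "rmin < 1"
    using r_bounds by auto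
qed

text \<open>Before its last letter the word still has ratio above \<open>t\<close>, and one letter
  costs at most the factor \<open>rmin\<close>. For \<open>[]\<close> the bound fails when
  \<open>t\<close> is large.\<close>

lemma ratio_cut_ge:
  assumes "w \<in> cut t" and "w \<noteq> []"
  shows "rmin * t \<le> ratio w"
proof -
  define v i where "v = butlast w" and "i = last w"
  have w: "w = v @ [i]"
    using assms by (simp add: v_def i_def)
  then have vi: "v \<in> lists \<Lambda>" "i \<in> \<Lambda>" "t < ratio v"
    using assms by (auto simp: cut_def)
  have "rmin * t \<le> rmin * ratio v"
    using vi rmin_bounds by simp
  also have "\<dots> \<le> r i * ratio v"
    using vi rmin_le_r ratio_pos by (intro mult_right_mono) (auto simp: less_imp_le)
  finally show ?thesis
    using w by (simp add: mult.commute)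
qed

text \<open>Cutting at level \<open>t < 1\<close> amounts to choosing a first letter \<open>i\<close> and then cutting at
  level \<open>t / r i \<ge> t / rmax\<close>, so level 1 is reached after boundedly many letters.\<close>

lemma cut_induct [consumes 1, case_names ge_1 less_1]:
  assumes "0 < t"
    and base: "\<And>t. 1 \<le> t \<Longrightarrow> P t"
    and step: "\<And>t. 0 < t \<Longrightarrow> t < 1 \<Longrightarrow> (\<And>i. i \<in> \<Lambda> \<Longrightarrow> P (t / r i)) \<Longrightarrow> P t"
  shows "P t"
proof -
  have *: "P s" if "0 < s" "rmax ^ n \<le> s" for n s
    using that
  proof (induction n arbitrary: s)
    case 0
    then show ?case
      using base by simp
  next
    case (Suc n)
    show ?case
    proof (cases "1 \<le> s")
      case False
      show ?thesis
      proof (rule step)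
        fix i assume i: "i \<in> \<Lambda>"
        have "rmax ^ n * r i \<le> rmax ^ Suc n"
          using r_le_rmax[OF i] rmax_bounds by simp
        also have "\<dots> \<le> s"
          by (rule Suc.prems)
        finally show "P (s / r i)"
          using Suc.prems r_bounds[OF i] by (intro Suc.IH) (auto simp: field_simps)
      qed (use False Suc.prems in auto)
    qed (use base in simp)
  qed
  obtain n where "rmax ^ n < t"
    using real_arch_pow_inv[OF \<open>0 < t\<close> rmax_bounds(2)] by blast
  then show ?thesis
    using * \<open>0 < t\<close> by (meson less_imp_le)
qed

lemma finite_cut: "0 < t \<Longrightarrow> finite (cut t)"
proof (induction t rule: cut_induct)
  case (less_1 t)
  then show ?case
    unfolding cut_less_1[OF less_1(2)] by (auto simp: finite_letters)
qed (simp add: cut_ge_1)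

text \<open>Self-similarity is iterated along each word until that word is stopped, hence a
  different number of times for different words.\<close>

lemma measure_eq_sum_cut:
  assumes "0 < t" and "A \<in> sets borel"
  shows "measure \<mu> A = (\<Sum>w\<in>cut t. weight w * measure \<mu> (foldr \<phi> w -` A))"
  using assms
proof (induction t arbitrary: A rule: cut_induct)
  case (ge_1 t)
  then show ?case
    by (simp add: cut_ge_1 id_def vimage_def)
next
  case (less_1 t)
  have "(\<Sum>w\<in>cut t. weight w * measure \<mu> (foldr \<phi> w -` A))
      = (\<Sum>i\<in>\<Lambda>. \<Sum>w\<in>(#) i ` cut (t / r i). weight w * measure \<mu> (foldr \<phi> w -` A))"
    unfolding cut_less_1[OF less_1(2)] using less_1 r_bounds
    by (intro sum.UNION_disjoint) (auto simp: finite_letters finite_cut)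
  also have "\<dots> = (\<Sum>i\<in>\<Lambda>. p i * (\<Sum>w\<in>cut (t / r i). weight w * measure \<mu> (foldr \<phi> w -` (\<phi> i -` A))))"
    by (simp add: sum.reindex sum_distrib_left mult.assoc vimage_comp)
  also have "\<dots> = (\<Sum>i\<in>\<Lambda>. p i * measure \<mu> (\<phi> i -` A))"
    using less_1(3)[symmetric] less_1(4) by (intro sum.cong refl) (simp add: \<phi>_vimage_borel)
  finally show ?case
    using measure_eq_sum[OF less_1(4)] by simp
qed

lemma sum_weight_cut: "0 < t \<Longrightarrow> (\<Sum>w\<in>cut t. weight w) = 1"
  using measure_eq_sum_cut[of t UNIV] prob_space by simp

lemma cut_coding:
  assumes "0 < t" and "x \<in> F"
  obtains w y where "w \<in> cut t" "y \<in> F" "x = foldr \<phi> w y"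
proof -
  have "\<exists>w\<in>cut t. x \<in> foldr \<phi> w ` F"
    using assms
  proof (induction t arbitrary: x rule: cut_induct)
    case (ge_1 t)
    then show ?case
      by (simp add: cut_ge_1)
  next
    case (less_1 t)
    obtain i z where z: "i \<in> \<Lambda>" "z \<in> F" "x = \<phi> i z"
      using F_eq less_1(4) by blast
    then obtain w where "w \<in> cut (t / r i)" "z \<in> foldr \<phi> w ` F"
      using less_1 by blast
    then show ?case
      using z by (intro bexI[of _ "i # w"]) (auto simp: cut_less_1[OF less_1(2)])
  qed
  then show ?thesis
    using that by blast
qed

text \<open>Distinct cut words branch at some first differing letter. Injectivity strips the common
  prefix, invariance of \<open>U\<close> keeps the images of the tails inside \<open>U\<close>, and
  the branching letters then separate them.\<close>

lemma disjoint_cut_images: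
  assumes "0 < t" and "w \<in> cut t" and "v \<in> cut t" and "w \<noteq> v"
    and U: "\<And>i. i \<in> \<Lambda> \<Longrightarrow> \<phi> i ` U \<subseteq> U"
    and disj: "\<And>i j. i \<in> \<Lambda> \<Longrightarrow> j \<in> \<Lambda> \<Longrightarrow> i \<noteq> j \<Longrightarrow> \<phi> i ` U \<inter> \<phi> j ` U = {}"
  shows "foldr \<phi> w ` U \<inter> foldr \<phi> v ` U = {}"
  using assms(1-4)
proof (induction t arbitrary: w v rule: cut_induct)
  case (ge_1 t)
  then show ?case
    by (simp add: cut_ge_1)
next
  case (less_1 t)
  obtain i w' j v' where wv: "w = i # w'" "i \<in> \<Lambda>" "w' \<in> cut (t / r i)"
      "v = j # v'" "j \<in> \<Lambda>" "v' \<in> cut (t / r j)"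
    using less_1 by (auto simp: cut_less_1)
  have *: "foldr \<phi> u ` U \<subseteq> U" if "u \<in> lists \<Lambda>" for u
    using that by (induction u) (use U in auto)
  show ?case
  proof (cases "i = j")
    case True
    then have "foldr \<phi> w' ` U \<inter> foldr \<phi> v' ` U = {}"
      using less_1 wv by blast
    moreover have "inj (\<phi> i)"
      using inj_word[of "[i]"] wv by simp
    ultimately show ?thesis
      using wv True by (auto dest: injD)
  next
    case False
    have "foldr \<phi> w' ` U \<subseteq> U" "foldr \<phi> v' ` U \<subseteq> U"
      using * wv cut_lists by blast+
    then have "foldr \<phi> w ` U \<subseteq> \<phi> i ` U" "foldr \<phi> v ` U \<subseteq> \<phi> j ` U"
      using wv by (auto simp: image_subset_iff)
    then show ?thesis
      using disj[OF wv(2,5) False] by blast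
  qed
qed

text \<open>For nonempty \<open>v\<close> both stopping conditions scale by \<open>ratio u\<close>.
  For \<open>v = []\<close> the bound \<open>t \<le> 1\<close> forces \<open>t = 1\<close>, and
  \<open>u\<close> is cut at its own ratio because its last letter strictly contracts.\<close>

lemma append_in_cut:
  assumes "u \<in> lists \<Lambda>" and "v \<in> cut t" and "t \<le> 1"
  shows "u @ v \<in> cut (ratio u * t)"
proof (cases "v = []")
  case True
  then have "t = 1"
    using assms by (simp add: cut_def)
  have "ratio u < ratio (butlast u)" if u_ne: "u \<noteq> []"
  proof -
    obtain u' i where u: "u = u' @ [i]"
      using u_ne by (metis append_butlast_last_id)
    then show ?thesis
      using assms(1) r_bounds[of i] ratio_pos[of u'] by simp
  qed
  then show ?thesis
    using True \<open>t = 1\<close> assms by (auto simp: cut_def)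
next
  case False
  then show ?thesis
    using assms ratio_pos[OF assms(1)] by (auto simp: cut_def butlast_append)
qed

section \<open>Measures of cylinder-sized balls\<close>

text \<open>The summand 1 keeps this positive even for a one-point \<open>F\<close>, so that
  \<open>\<Delta> * ratio u\<close> is a genuine radius; a ball of this radius around a point of a
  cylinder contains the whole cylinder.\<close>

definition \<Delta> :: real where "\<Delta> = diameter F + 1"

lemma \<Delta>_pos: "0 < \<Delta>"
  using diameter_ge_0[OF compact_imp_bounded[OF compact_F]] by (simp add: \<Delta>_def)

lemma dist_le_\<Delta>: "x \<in> F \<Longrightarrow> y \<in> F \<Longrightarrow> dist x y \<le> \<Delta>"
  using diameter_bounded_bound[OF compact_imp_bounded[OF compact_F], of x y] by (simp add: \<Delta>_def)

text \<open>Fix a ball around \<open>a\<close> inside the open set. Its images under the words of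
  one cut are disjoint and have radius comparable to \<open>t\<close>, so the images of
  \<open>a\<close> are separated, while nearness of the cylinders confines them to a ball of radius
  comparable to \<open>t\<close>.\<close>

lemma card_cut_near_le:
  assumes "open_set_condition \<Lambda> \<phi>"
  obtains N where "\<And>t x. 0 < t \<Longrightarrow> t \<le> 1 \<Longrightarrow> card {v \<in> cut t. \<exists>z\<in>F. dist x (foldr \<phi> v z) \<le> t} \<le> N"
proof -
  obtain U where U: "open U" "U \<noteq> {}" "\<forall>i\<in>\<Lambda>. \<phi> i ` U \<subseteq> U"
    and disj: "\<forall>i\<in>\<Lambda>. \<forall>j\<in>\<Lambda>. i \<noteq> j \<longrightarrow> \<phi> i ` U \<inter> \<phi> j ` U = {}"
    using assms unfolding open_set_condition_def by (elim exE conjE)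
  obtain a \<rho> where a: "0 < \<rho>" "ball a \<rho> \<subseteq> U"
    using U(1,2) by (meson all_not_in_conv open_contains_ball)
  have "bounded F"
    by (rule compact_imp_bounded[OF compact_F])
  then obtain M where M: "\<And>z. z \<in> F \<Longrightarrow> dist a z \<le> M"
    unfolding bounded_any_center[where a = a] by blast
  have sep_pos: "0 < rmin * \<rho>"
    using a rmin_bounds by simp
  \<comment> \<open>In \<open>1 + M\<close> the 1 is the distance from \<open>x\<close> to the
    cylinder and \<open>M\<close> the distance inside it to the image of \<open>a\<close>, both in
    units of \<open>t\<close>.\<close>
  obtain N :: nat where N: "\<forall>(I :: 'i list set) f (x :: 'a) t. 0 < t \<longrightarrow> f ` I \<subseteq> cball x ((1 + M) * t) \<longrightarrow>
      (\<forall>i\<in>I. \<forall>j\<in>I. i \<noteq> j \<longrightarrow> (rmin * \<rho>) * t \<le> dist (f i) (f j)) \<longrightarrow> card I \<le> N"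
    using packing_bound[OF sep_pos, of "1 + M"] by (elim exE)
  show ?thesis
  proof (rule that)
    fix t :: real and x :: 'a
    assume t: "0 < t" "t \<le> 1"
    let ?I = "{v \<in> cut t. \<exists>z\<in>F. dist x (foldr \<phi> v z) \<le> t}"
    have near: "dist x (foldr \<phi> v a) \<le> (1 + M) * t" if v: "v \<in> ?I" for v
    proof -
      obtain z where z: "z \<in> F" "dist x (foldr \<phi> v z) \<le> t"
        using v by blast
      have vl: "v \<in> lists \<Lambda>" "ratio v \<le> t"
        using v by (auto simp: cut_def)
      have "dist (foldr \<phi> v z) (foldr \<phi> v a) \<le> t * M"
        using M[OF z(1)] vl ratio_pos[OF vl(1)] t
        by (simp add: dist_word[OF vl(1)] dist_commute mult_mono)
      then show ?thesis
        using z(2) dist_triangle[of x "foldr \<phi> v a" "foldr \<phi> v z"] by (simp add: algebra_simps)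
    qed
    have sep: "(rmin * \<rho>) * t \<le> dist (foldr \<phi> v a) (foldr \<phi> w a)"
      if vw: "v \<in> ?I" "w \<in> ?I" "v \<noteq> w" for v w
    proof -
      have l: "v \<in> lists \<Lambda>" "w \<in> lists \<Lambda>"
        using vw cut_lists by auto
      have img: "foldr \<phi> u ` ball a \<rho> = ball (foldr \<phi> u a) (ratio u * \<rho>)" if "u \<in> lists \<Lambda>" for u
        using that ratio_pos dist_word by (intro similarity_image_ball)
      have "foldr \<phi> v ` U \<inter> foldr \<phi> w ` U = {}"
        using vw t U(3)[rule_format] disj[rule_format] by (intro disjoint_cut_images[of t]) simp_all
      then have "foldr \<phi> v ` ball a \<rho> \<inter> foldr \<phi> w ` ball a \<rho> = {}"
        using a(2) by blast
      then have "ball (foldr \<phi> v a) (ratio v * \<rho>) \<inter> ball (foldr \<phi> w a) (ratio w * \<rho>) = {}"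
        by (simp only: img[OF l(1)] img[OF l(2)])
      then have "ratio v * \<rho> \<le> dist (foldr \<phi> v a) (foldr \<phi> w a)"
        using ratio_pos[OF l(2)] a(1) by (rule dist_centres_ge_of_disjoint_balls[OF _ mult_pos_pos])
      \<comment> \<open>The empty word escapes \<open>ratio_cut_ge\<close>; there
        \<open>t \<le> 1\<close> gives the bound.\<close>
      moreover have "rmin * t \<le> ratio v"
      proof (cases "v = []")
        case True
        then show ?thesis
          using t rmin_bounds by (simp add: mult_le_one)
      next
        case False
        then show ?thesis
          using vw(1) ratio_cut_ge by simp
      qed
      then have "(rmin * t) * \<rho> \<le> ratio v * \<rho>"
        using a(1) by simp
      ultimately show ?thesis
        by (simp add: mult_ac)
    qed
    show "card ?I \<le> N"
    proof (rule N[rule_format, OF t(1), of "\<lambda>v. foldr \<phi> v a" _ x])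
      show "(\<lambda>v. foldr \<phi> v a) ` ?I \<subseteq> cball x ((1 + M) * t)"
        using near by (intro image_subsetI) simp
    qed (rule sep)
  qed
qed

text \<open>Choose a word \<open>w\<close> having the largest number of neighbours of comparable size.
  Prefixing by \<open>u\<close> embeds its neighbours into those of \<open>u @ w\<close>, so by maximality all neighbours
  of \<open>u @ w\<close> start with \<open>u\<close>. This replaces the strong open set condition.\<close>

lemma isolated_point:
  assumes "open_set_condition \<Lambda> \<phi>"
  obtains z \<epsilon> where "z \<in> F" "0 < \<epsilon>"
    "\<And>u. u \<in> lists \<Lambda> \<Longrightarrow> measure \<mu> (cball (foldr \<phi> u z) (ratio u * \<epsilon>)) \<le> weight u"
proof -
  obtain z0 where z0: "z0 \<in> F"
    using limit_set unfolding is_limit_set_def by blast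
  define nb where "nb w = {v \<in> cut (ratio w). \<exists>z\<in>F. dist (foldr \<phi> w z0) (foldr \<phi> v z) \<le> ratio w}" for w
  obtain N where N: "\<And>t x. 0 < t \<Longrightarrow> t \<le> 1 \<Longrightarrow> card {v \<in> cut t. \<exists>z\<in>F. dist x (foldr \<phi> v z) \<le> t} \<le> N"
    using card_cut_near_le[OF assms] by blast
  have "card (nb w) < Suc N" if "w \<in> lists \<Lambda>" for w
    using N[OF ratio_pos[OF that] ratio_le_1[OF that]] by (simp add: nb_def less_Suc_eq_le)
  \<comment> \<open>The maximum exists because \<open>N\<close> bounds the number of neighbours of
    all words at once.\<close>
  then obtain w where w: "w \<in> lists \<Lambda>" and max: "\<And>v. v \<in> lists \<Lambda> \<Longrightarrow> card (nb v) \<le> card (nb w)"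
    using ex_has_greatest_nat[of "\<lambda>w. w \<in> lists \<Lambda>" "[]" "\<lambda>w. card (nb w)" "Suc N"] by auto
  have "measure \<mu> (cball (foldr \<phi> u (foldr \<phi> w z0)) (ratio u * ratio w)) \<le> weight u"
    if u: "u \<in> lists \<Lambda>" for u
  proof -
    let ?B = "cball (foldr \<phi> u (foldr \<phi> w z0)) (ratio u * ratio w)"
    have uw: "u @ w \<in> lists \<Lambda>" and pos: "0 < ratio u" "0 < ratio w" "0 < ratio u * ratio w"
      using u w ratio_pos by auto
    have fin: "finite (cut (ratio u * ratio w))" "finite (cut (ratio w))"
      using pos finite_cut by auto
    have "(@) u ` nb w \<subseteq> nb (u @ w)"
      using append_in_cut[OF u _ ratio_le_1[OF w]] pos by (auto simp: nb_def dist_word[OF u])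
    moreover have "card ((@) u ` nb w) = card (nb w)"
      by (intro card_image inj_onI) simp
    moreover have "finite (nb (u @ w))"
      using fin by (simp add: nb_def)
    ultimately have eq: "nb (u @ w) = (@) u ` nb w"
      using card_seteq max[OF uw] by metis
    \<comment> \<open>The ball is expanded over cylinders of its own size. Those of non-neighbours
      miss it, and all the others carry the factor \<open>weight u\<close>.\<close>
    have "measure \<mu> ?B = (\<Sum>v\<in>cut (ratio u * ratio w). weight v * measure \<mu> (foldr \<phi> v -` ?B))"
      using pos by (intro measure_eq_sum_cut) auto
    also have "\<dots> = (\<Sum>v\<in>nb (u @ w). weight v * measure \<mu> (foldr \<phi> v -` ?B))"
    proof (rule sum.mono_neutral_right)
      show "\<forall>v\<in>cut (ratio u * ratio w) - nb (u @ w). weight v * measure \<mu> (foldr \<phi> v -` ?B) = 0"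
      proof
        fix v assume "v \<in> cut (ratio u * ratio w) - nb (u @ w)"
        then have "foldr \<phi> v -` ?B \<inter> F = {}"
          by (auto simp: nb_def)
        then show "weight v * measure \<mu> (foldr \<phi> v -` ?B) = 0"
          using measure_disjoint_F by simp
      qed
    qed (use fin in \<open>auto simp: nb_def\<close>)
    also have "\<dots> \<le> (\<Sum>v\<in>nb (u @ w). weight v)"
      using weight_pos cut_lists by (intro sum_mono mult_left_le) (auto simp: nb_def less_imp_le subset_iff)
    also have "\<dots> = weight u * (\<Sum>v\<in>nb w. weight v)"
      unfolding eq by (subst sum.reindex) (auto simp: inj_on_def sum_distrib_left)
    also have "(\<Sum>v\<in>nb w. weight v) \<le> (\<Sum>v\<in>cut (ratio w). weight v)"
      using fin weight_pos cut_lists by (intro sum_mono2) (auto simp: nb_def less_imp_le subset_iff)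
    also have "\<dots> = 1"
      using pos by (simp add: sum_weight_cut)
    finally show ?thesis
      using weight_pos[OF u] by simp
  qed
  then show ?thesis
    using that[of "foldr \<phi> w z0" "ratio w"] word_in_F[OF w z0] ratio_pos[OF w] by blast
qed

section \<open>Comparison of ball measures with weights\<close>

lemma doubling_scale:
  assumes "doubling_on F \<mu>"
  obtains C where "0 < C" "\<And>x s. x \<in> F \<Longrightarrow> 0 < s \<Longrightarrow> measure \<mu> (cball x (c * s)) \<le> C * measure \<mu> (cball x s)"
proof -
  obtain C where C: "1 \<le> C" "\<And>x s. x \<in> F \<Longrightarrow> 0 < s \<Longrightarrow> measure \<mu> (cball x (2 * s)) \<le> C * measure \<mu> (cball x s)"
    using assms unfolding doubling_on_def by blast
  have pow: "measure \<mu> (cball x (2 ^ k * s)) \<le> C ^ k * measure \<mu> (cball x s)"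
    if "x \<in> F" "0 < s" for x s k
  proof (induction k)
    case (Suc k)
    have "measure \<mu> (cball x (2 * (2 ^ k * s))) \<le> C * measure \<mu> (cball x (2 ^ k * s))"
      using that by (intro C(2)) auto
    also have "\<dots> \<le> C * (C ^ k * measure \<mu> (cball x s))"
      using Suc C(1) by simp
    finally show ?case
      by (simp add: mult.assoc)
  qed simp
  obtain k where k: "c < 2 ^ k"
    using real_arch_pow[of 2 c] by auto
  show ?thesis
  proof (rule that[of "C ^ k"])
    fix x s assume x: "x \<in> F" "(0::real) < s"
    have "measure \<mu> (cball x (c * s)) \<le> measure \<mu> (cball x (2 ^ k * s))"
      using k x by (intro finite_measure_mono subset_cball) auto
    also have "\<dots> \<le> C ^ k * measure \<mu> (cball x s)"
      using pow x by blast
    finally show "measure \<mu> (cball x (c * s)) \<le> C ^ k * measure \<mu> (cball x s)" .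
  qed (use C in simp)
qed

lemma weight_le_measure_cball:
  assumes "u \<in> lists \<Lambda>" and "y \<in> F"
  shows "weight u \<le> measure \<mu> (cball (foldr \<phi> u y) (\<Delta> * ratio u))"
  using assms ratio_pos[OF assms(1)]
  by (intro weight_le_measure) (auto simp: dist_word[OF assms(1)] dist_le_\<Delta> mult.commute[of \<Delta>])

lemma measure_cball_le_weight:
  assumes "open_set_condition \<Lambda> \<phi>" and "doubling_on F \<mu>"
  obtains C where "0 < C"
    "\<And>u y. u \<in> lists \<Lambda> \<Longrightarrow> y \<in> F \<Longrightarrow> measure \<mu> (cball (foldr \<phi> u y) (\<Delta> * ratio u)) \<le> C * weight u"
proof -
  obtain z \<epsilon> where z: "z \<in> F" "0 < \<epsilon>"
    "\<And>u. u \<in> lists \<Lambda> \<Longrightarrow> measure \<mu> (cball (foldr \<phi> u z) (ratio u * \<epsilon>)) \<le> weight u"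
    using isolated_point[OF assms(1)] by blast
  \<comment> \<open>A ball of radius \<open>\<Delta> * ratio u\<close> around any point of the
    cylinder lies in one of radius \<open>2 * \<Delta> * ratio u\<close> around the image of
    \<open>z\<close>, which is \<open>2 * \<Delta> / \<epsilon>\<close> times the radius where the
    bound is known.\<close>
  obtain C where C: "0 < C" "\<And>x s. x \<in> F \<Longrightarrow> 0 < s \<Longrightarrow>
      measure \<mu> (cball x ((2 * \<Delta> / \<epsilon>) * s)) \<le> C * measure \<mu> (cball x s)"
    using doubling_scale[OF assms(2)] by blast
  show ?thesis
  proof (rule that[OF C(1)])
    fix u y assume u: "u \<in> lists \<Lambda>" and y: "y \<in> F"
    have pos: "0 < ratio u"
      using u by (rule ratio_pos)
    have "dist (foldr \<phi> u z) (foldr \<phi> u y) \<le> ratio u * \<Delta>"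
      using z(1) y pos by (simp add: dist_word[OF u] dist_le_\<Delta>)
    then have "cball (foldr \<phi> u y) (\<Delta> * ratio u) \<subseteq> cball (foldr \<phi> u z) (2 * \<Delta> * ratio u)"
      by (simp add: cball_subset_cball_iff dist_commute mult.commute[of \<Delta>])
    then have "measure \<mu> (cball (foldr \<phi> u y) (\<Delta> * ratio u)) \<le> measure \<mu> (cball (foldr \<phi> u z) (2 * \<Delta> * ratio u))"
      by (intro finite_measure_mono) auto
    also have "2 * \<Delta> * ratio u = (2 * \<Delta> / \<epsilon>) * (ratio u * \<epsilon>)"
      using z(2) by simp
    also have "measure \<mu> (cball (foldr \<phi> u z) \<dots>) \<le> C * measure \<mu> (cball (foldr \<phi> u z) (ratio u * \<epsilon>))"
      using C(2)[OF word_in_F[OF u z(1)], of "ratio u * \<epsilon>"] pos z(2) by simp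
    also have "\<dots> \<le> C * weight u"
      using z(3)[OF u] C(1) by simp
    finally show "measure \<mu> (cball (foldr \<phi> u y) (\<Delta> * ratio u)) \<le> C * weight u" .
  qed
qed

section \<open>The global upper bound\<close>

text \<open>Each quotient is the exponent \<open>s\<close> with
  \<open>p i = r i powr s\<close>.\<close>

definition max_exponent :: real where
  "max_exponent = Max ((\<lambda>i. ln (p i) / ln (r i)) ` \<Lambda>)"

lemma exponent_le_max: "i \<in> \<Lambda> \<Longrightarrow> ln (p i) / ln (r i) \<le> max_exponent"
  unfolding max_exponent_def by (intro Max_ge) (auto simp: finite_letters)

lemma max_exponent_attained: obtains i where "i \<in> \<Lambda>" "max_exponent = ln (p i) / ln (r i)"
proof -
  have "max_exponent \<in> (\<lambda>i. ln (p i) / ln (r i)) ` \<Lambda>"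
    unfolding max_exponent_def by (intro Max_in) (auto simp: letters_nonempty finite_letters)
  then show ?thesis
    using that by blast
qed

lemma max_exponent_pos: "0 < max_exponent"
proof -
  obtain i where i: "i \<in> \<Lambda>" "max_exponent = ln (p i) / ln (r i)"
    by (rule max_exponent_attained)
  then show ?thesis
    using r_bounds[of i] p_bounds[of i] by (simp add: divide_neg_neg)
qed

text \<open>Since \<open>r i < 1\<close>, raising the exponent from that of \<open>i\<close> to the
  maximum lowers the power, so the inequality holds for each letter and is multiplicative.\<close>

lemma ratio_powr_le_weight: "w \<in> lists \<Lambda> \<Longrightarrow> ratio w powr max_exponent \<le> weight w"
proof (induction w)
  case (Cons i w)
  then have i: "i \<in> \<Lambda>"
    by simp
  have "max_exponent * ln (r i) \<le> ln (p i)"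
    using exponent_le_max[OF i] r_bounds[OF i] by (simp add: neg_divide_le_eq)
  then have "r i powr max_exponent \<le> p i"
    using r_bounds[OF i] p_bounds[OF i] by (simp add: powr_def ln_ge_iff)
  then show ?case
    using Cons r_bounds[OF i] p_bounds[OF i] ratio_pos[of w]
    by (auto simp: powr_mult intro!: mult_mono)
qed simp

text \<open>A code of \<open>x\<close> is cut at scale \<open>t\<close> into \<open>u\<close> and
  continued by \<open>v\<close> to scale \<open>s\<close>. The larger ball has measure at most a
  constant times \<open>weight u\<close>, the smaller at least \<open>weight u * weight v\<close>,
  so only \<open>1 / weight v\<close> remains.\<close>

lemma measure_ratio_le:
  assumes "open_set_condition \<Lambda> \<phi>" and "doubling_on F \<mu>"
  obtains C where "0 < C" "\<And>x s t. x \<in> F \<Longrightarrow> 0 < s \<Longrightarrow> s < t \<Longrightarrow>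
    measure \<mu> (cball x t) / measure \<mu> (cball x s) \<le> C * (t / s) powr max_exponent"
proof -
  obtain C where C: "0 < C"
    "\<And>u y. u \<in> lists \<Lambda> \<Longrightarrow> y \<in> F \<Longrightarrow> measure \<mu> (cball (foldr \<phi> u y) (\<Delta> * ratio u)) \<le> C * weight u"
    using measure_cball_le_weight[OF assms] by blast
  obtain C' where C': "0 < C'" "\<And>x s. x \<in> F \<Longrightarrow> 0 < s \<Longrightarrow>
      measure \<mu> (cball x ((1 / rmin) * s)) \<le> C' * measure \<mu> (cball x s)"
    using doubling_scale[OF assms(2)] by blast
  \<comment> \<open>The 1 serves \<open>u = []\<close>, that is large \<open>t\<close>, where the
    trivial bound \<open>prob_le_1\<close> is used; \<open>C' * C\<close> serves all other
    \<open>u\<close>.\<close>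
  define K where "K = max 1 (C' * C)"
  have K: "0 < K" "1 \<le> K" "C' * C \<le> K"
    by (auto simp: K_def)
  show ?thesis
  proof (rule that[of "K * (1 / rmin) powr max_exponent"])
    fix x s t assume x: "x \<in> F" and s: "(0::real) < s" "s < t"
    obtain u y where u: "u \<in> cut (t / \<Delta>)" "y \<in> F" "x = foldr \<phi> u y"
      using cut_coding[of "t / \<Delta>" x] x s \<Delta>_pos by auto
    have ul: "u \<in> lists \<Lambda>" "ratio u \<le> t / \<Delta>"
      using u by (auto simp: cut_def)
    then have ru: "0 < ratio u"
      by (simp add: ratio_pos)
    \<comment> \<open>Cutting the code of \<open>y\<close> at a level relative to
      \<open>ratio u\<close> makes \<open>u @ v\<close> an extension of \<open>u\<close>. The level
      may reach 1, and then \<open>v = []\<close>.\<close>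
    obtain v z where v: "v \<in> cut (s / \<Delta> / ratio u)" "z \<in> F" "y = foldr \<phi> v z"
      using cut_coding[of "s / \<Delta> / ratio u" y] u s \<Delta>_pos ru by auto
    have vl: "v \<in> lists \<Lambda>" "ratio v \<le> s / \<Delta> / ratio u"
      using v by (auto simp: cut_def)
    then have rv: "0 < ratio v"
      by (simp add: ratio_pos)
    have "weight (u @ v) \<le> measure \<mu> (cball x (\<Delta> * ratio (u @ v)))"
      using weight_le_measure_cball[of "u @ v" z] ul vl u v by simp
    also have "\<dots> \<le> measure \<mu> (cball x s)"
      using vl(2) ru \<Delta>_pos by (intro finite_measure_mono subset_cball) (auto simp: field_simps)
    finally have lower: "weight u * weight v \<le> measure \<mu> (cball x s)"
      by simp
    have upper: "measure \<mu> (cball x t) \<le> K * weight u"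
    proof (cases "u = []")
      case True
      then show ?thesis
        using order_trans[OF prob_le_1 K(2)] by simp
    next
      case False
      then have "rmin * (t / \<Delta>) \<le> ratio u"
        using ratio_cut_ge u(1) by blast
      then have "t \<le> (1 / rmin) * (\<Delta> * ratio u)"
        using rmin_bounds \<Delta>_pos by (simp add: field_simps)
      then have "measure \<mu> (cball x t) \<le> measure \<mu> (cball x ((1 / rmin) * (\<Delta> * ratio u)))"
        by (intro finite_measure_mono subset_cball) auto
      also have "\<dots> \<le> C' * measure \<mu> (cball x (\<Delta> * ratio u))"
        using x \<Delta>_pos ru by (intro C'(2)) auto
      also have "\<dots> \<le> C' * (C * weight u)"
        using C(2)[OF ul(1) u(2)] C'(1) u(3) by simp
      also have "\<dots> \<le> K * weight u"
        using mult_right_mono[OF K(3), of "weight u"] weight_pos[OF ul(1)] by (simp add: mult.assoc)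
      finally show ?thesis .
    qed
    \<comment> \<open>The factor \<open>1 / rmin\<close> pays for the overshoot of the last letter
      of \<open>v\<close>; for \<open>v = []\<close> it is enough that \<open>s < t\<close>.\<close>
    have "1 / ratio v \<le> (1 / rmin) * (t / s)"
    proof (cases "v = []")
      case True
      have "rmin * s \<le> 1 * t"
        using rmin_bounds s by (intro mult_mono) auto
      then show ?thesis
        using True rmin_bounds s by (simp add: field_simps)
    next
      case False
      then have "rmin * (s / \<Delta> / ratio u) \<le> ratio v"
        using ratio_cut_ge v(1) by blast
      then have "rmin * s \<le> ratio v * (\<Delta> * ratio u)"
        using ru \<Delta>_pos by (simp add: field_simps)
      also have "\<dots> \<le> ratio v * t"
        using ul(2) \<Delta>_pos rv by (intro mult_left_mono) (auto simp: field_simps)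
      finally show ?thesis
        using rv s rmin_bounds by (simp add: field_simps)
    qed
    then have "(1 / ratio v) powr max_exponent \<le> ((1 / rmin) * (t / s)) powr max_exponent"
      using rv max_exponent_pos by (intro powr_mono2) auto
    then have pw: "1 / (ratio v powr max_exponent) \<le> (1 / rmin) powr max_exponent * (t / s) powr max_exponent"
      using rv rmin_bounds s by (simp add: powr_mult powr_divide)
    have "measure \<mu> (cball x t) / measure \<mu> (cball x s) \<le> (K * weight u) / (weight u * weight v)"
      using lower upper weight_pos[OF ul(1)] weight_pos[OF vl(1)] K by (intro frac_le) auto
    also have "\<dots> = K * (1 / weight v)"
      using weight_pos[OF ul(1)] by simp
    also have "\<dots> \<le> K * (1 / (ratio v powr max_exponent))"
      using ratio_powr_le_weight[OF vl(1)] rv K by (intro mult_left_mono divide_left_mono) (auto simp: weight_pos vl)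
    also have "\<dots> \<le> K * ((1 / rmin) powr max_exponent * (t / s) powr max_exponent)"
      using pw K by (intro mult_left_mono) auto
    finally show "measure \<mu> (cball x t) / measure \<mu> (cball x s) \<le> K * (1 / rmin) powr max_exponent * (t / s) powr max_exponent"
      by (simp add: mult.assoc)
  qed (use K rmin_bounds in simp)
qed

lemma assouad_dim_le_max_exponent:
  assumes "open_set_condition \<Lambda> \<phi>" and "doubling_on F \<mu>"
  shows "assouad_dim F \<mu> \<le> ereal max_exponent"
proof -
  obtain C where "0 < C" "\<And>x s t. x \<in> F \<Longrightarrow> 0 < s \<Longrightarrow> s < t \<Longrightarrow>
    measure \<mu> (cball x t) / measure \<mu> (cball x s) \<le> C * (t / s) powr max_exponent"
    using measure_ratio_le[OF assms] by blast
  then show ?thesis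
    unfolding assouad_dim_def using max_exponent_pos by (intro Inf_lower imageI) blast
qed

lemma pointwise_assouad_dim_le:
  assumes "x \<in> F"
  shows "pointwise_assouad_dim \<mu> x \<le> assouad_dim F \<mu>"
  unfolding assouad_dim_def pointwise_assouad_dim_def
proof (intro Inf_superset_mono image_mono Collect_mono impI)
  fix s :: real
  assume "0 < s \<and> (\<exists>C>0. \<forall>x\<in>F. \<forall>r R. 0 < r \<and> r < R \<longrightarrow>
    measure \<mu> (cball x R) / measure \<mu> (cball x r) \<le> C * (R / r) powr s)"
  with assms show "0 < s \<and> (\<exists>C>0. \<forall>r R. 0 < r \<and> r < R \<longrightarrow>
    measure \<mu> (cball x R) / measure \<mu> (cball x r) \<le> C * (R / r) powr s)"
    by meson
qed

section \<open>The almost sure lower bound\<close>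

text \<open>The exceptional set \<open>N\<close> satisfies \<open>\<phi> j -` N \<subseteq> N\<close>, so self-similarity forces
  \<open>\<phi> i -` A\<close> to have the measure of \<open>N\<close> whenever \<open>A \<subseteq> N\<close> does.
  Pulling \<open>N\<close> back \<open>n\<close> times leads outside \<open>F\<close>.\<close>

lemma AE_code_contains_power:
  assumes i: "i \<in> \<Lambda>"
  shows "AE x in \<mu>. \<exists>u\<in>lists \<Lambda>. x \<in> foldr \<phi> (u @ replicate n i) ` F"
proof -
  define E where "E = (\<Union>u\<in>lists \<Lambda>. foldr \<phi> (u @ replicate n i) ` F)"
  define N where "N = - E"
  have "compact (foldr \<phi> (u @ replicate n i) ` F)" if "u \<in> lists \<Lambda>" for u
  proof (rule compact_continuous_image)
    have "u @ replicate n i \<in> lists \<Lambda>"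
      using that i by auto
    then show "continuous_on F (foldr \<phi> (u @ replicate n i))"
      by (rule continuous_word)
  qed (rule compact_F)
  then have "E \<in> sets borel"
    unfolding E_def using finite_letters
    by (intro sets.countable_UN' countable_lists image_subsetI borel_compact) (simp_all add: countable_finite)
  then have N_borel: "N \<in> sets borel"
    by (simp add: N_def)
  have pull: "\<phi> j -` N \<subseteq> N" if "j \<in> \<Lambda>" for j
  proof -
    have "\<phi> j x \<in> E" if "x \<in> E" for x
    proof -
      obtain u y where u: "u \<in> lists \<Lambda>" "y \<in> F" "x = foldr \<phi> (u @ replicate n i) y"
        using \<open>x \<in> E\<close> unfolding E_def by blast
      then have "j # u \<in> lists \<Lambda>" "\<phi> j x = foldr \<phi> ((j # u) @ replicate n i) y"
        using \<open>j \<in> \<Lambda>\<close> by auto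
      then show ?thesis
        unfolding E_def using u(2) by blast
    qed
    then show ?thesis
      by (auto simp: N_def)
  qed
  have step: "measure \<mu> (\<phi> i -` A) = measure \<mu> N"
    if A: "A \<in> sets borel" "A \<subseteq> N" "measure \<mu> A = measure \<mu> N" for A
  proof -
    have le: "measure \<mu> (\<phi> j -` A) \<le> measure \<mu> N" if "j \<in> \<Lambda>" for j
      using pull[OF that] A(2) N_borel by (intro finite_measure_mono) auto
    \<comment> \<open>A weighted average of numbers at most \<open>measure \<mu> N\<close> equals
      this bound, so with positive weights every one of them does.\<close>
    have "(\<Sum>j\<in>\<Lambda>. p j * (measure \<mu> N - measure \<mu> (\<phi> j -` A))) = 0"
      using measure_eq_sum[OF A(1)] A(3) sum_p
      by (simp add: right_diff_distrib sum_subtractf flip: sum_distrib_right)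
    then have "p i * (measure \<mu> N - measure \<mu> (\<phi> i -` A)) = 0"
      using i le p_bounds finite_letters
      by (subst (asm) sum_nonneg_eq_0_iff) (auto simp: less_imp_le)
    then show ?thesis
      using p_bounds[OF i] by simp
  qed
  have "foldr \<phi> (replicate k i) -` N \<in> sets borel \<and> foldr \<phi> (replicate k i) -` N \<subseteq> N \<and>
    measure \<mu> (foldr \<phi> (replicate k i) -` N) = measure \<mu> N" for k
  proof (induction k)
    case 0
    then show ?case
      using N_borel by (simp add: id_def vimage_def)
  next
    case (Suc k)
    let ?A = "foldr \<phi> (replicate k i) -` N"
    \<comment> \<open>The new letter is split off at the inner end, which makes the new set the
      preimage of \<open>?A\<close> under a single map.\<close>
    have eq: "foldr \<phi> (replicate (Suc k) i) -` N = \<phi> i -` ?A"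
    proof -
      have "replicate (Suc k) i = replicate k i @ [i]"
        by (simp add: replicate_append_same)
      then show ?thesis
        by (simp only: foldr_append) auto
    qed
    have "\<phi> i -` ?A \<subseteq> N"
      using Suc pull[OF i] by blast
    then show ?case
      unfolding eq using Suc step \<phi>_vimage_borel[OF i] by blast
  qed
  moreover have "foldr \<phi> (replicate n i) -` N \<inter> F = {}"
  proof -
    have "foldr \<phi> ([] @ replicate n i) y \<in> E" if "y \<in> F" for y
      unfolding E_def using that by blast
    then show ?thesis
      by (auto simp: N_def)
  qed
  ultimately have "measure \<mu> N = 0"
    using measure_disjoint_F by metis
  then have "N \<in> null_sets \<mu>"
    using N_borel by (auto simp: null_sets_def emeasure_eq_measure)
  then show ?thesis
    by (rule AE_I') (auto simp: N_def E_def)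
qed

text \<open>At the scales of \<open>u\<close> and of \<open>u\<close> followed by \<open>n\<close>
  letters \<open>i\<close>, the radii have quotient \<open>1 / r i ^ n\<close> and the measures at
  least \<open>1 / (C * p i ^ n)\<close>. The word \<open>u\<close> may change with
  \<open>n\<close>, since the constants do not depend on it. Large \<open>n\<close> forces
  \<open>r i powr e \<le> p i\<close>.\<close>

lemma exponent_le_pointwise_assouad_dim:
  assumes "open_set_condition \<Lambda> \<phi>" and "doubling_on F \<mu>" and i: "i \<in> \<Lambda>"
    and x: "\<And>n. \<exists>u\<in>lists \<Lambda>. x \<in> foldr \<phi> (u @ replicate n i) ` F"
  shows "ereal (ln (p i) / ln (r i)) \<le> pointwise_assouad_dim \<mu> x"
  unfolding pointwise_assouad_dim_def
proof (rule Inf_greatest, clarify)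
  fix e C' :: real
  assume "0 < C'" and C': "\<forall>s t. 0 < s \<and> s < t \<longrightarrow> measure \<mu> (cball x t) / measure \<mu> (cball x s) \<le> C' * (t / s) powr e"
  obtain C where C: "0 < C"
    "\<And>u y. u \<in> lists \<Lambda> \<Longrightarrow> y \<in> F \<Longrightarrow> measure \<mu> (cball (foldr \<phi> u y) (\<Delta> * ratio u)) \<le> C * weight u"
    using measure_cball_le_weight[OF assms(1,2)] by blast
  define q where "q = r i powr e / p i"
  have "q ^ n \<le> C * C'" if "0 < n" for n
  proof -
    obtain u y where u: "u \<in> lists \<Lambda>" "y \<in> F" "x = foldr \<phi> (u @ replicate n i) y"
      using x[of n] by blast
    let ?v = "replicate n i"
    have v: "?v \<in> lists \<Lambda>"
      using i by auto
    have rv: "ratio ?v = r i ^ n" and wv: "weight ?v = p i ^ n"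
      by (simp_all add: ratio_def weight_def)
    define s t where "s = \<Delta> * ratio (u @ ?v)" and "t = \<Delta> * ratio u"
    have pos: "0 < s" "0 < t" "0 < weight u"
      using u v ratio_pos \<Delta>_pos r_bounds[OF i] weight_pos by (auto simp: s_def t_def rv)
    have ts: "t / s = 1 / r i ^ n"
      using pos by (auto simp: s_def t_def rv)
    have "r i ^ n < 1"
      using r_bounds[OF i] that by (simp add: power_less_one_iff)
    then have "s < t"
      using mult_strict_left_mono[of "r i ^ n" 1 t] pos by (simp add: s_def t_def rv mult.assoc)
    have m: "weight u \<le> measure \<mu> (cball x t)" "measure \<mu> (cball x s) \<le> C * weight (u @ ?v)"
      "weight (u @ ?v) \<le> measure \<mu> (cball x s)"
      using weight_le_measure_cball[OF u(1) word_in_F[OF v u(2)]] C(2)[of "u @ ?v" y]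
        weight_le_measure_cball[of "u @ ?v" y] u v
      by (simp_all add: s_def t_def)
    have "0 < weight (u @ ?v)"
      using u v by (intro weight_pos) auto
    then have ms: "0 < measure \<mu> (cball x s)"
      using m(3) by linarith
    have "1 / (C * p i ^ n) = weight u / (C * weight (u @ ?v))"
      using pos by (simp add: wv)
    also have "\<dots> \<le> measure \<mu> (cball x t) / measure \<mu> (cball x s)"
      using m ms pos by (intro frac_le) auto
    also have "\<dots> \<le> C' * (t / s) powr e"
      using C' pos \<open>s < t\<close> by blast
    also have "(t / s) powr e = 1 / (r i powr e) ^ n"
      using r_bounds[OF i] by (simp add: ts powr_divide powr_realpow[symmetric] powr_powr mult.commute)
    finally show ?thesis
      using C(1) r_bounds[OF i] p_bounds[OF i] by (simp add: q_def field_simps)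
  qed
  have "q \<le> 1"
  proof (rule ccontr)
    assume "\<not> q \<le> 1"
    then obtain n where n: "C * C' < q ^ n"
      using real_arch_pow[of q "C * C'"] by auto
    \<comment> \<open>The bound is known only for positive exponents, as \<open>s < t\<close> is
      strict; passing to \<open>Suc n\<close> covers \<open>n = 0\<close>.\<close>
    also have "q ^ n \<le> q ^ Suc n"
      using \<open>\<not> q \<le> 1\<close> by (intro power_increasing) auto
    finally show False
      using \<open>\<And>n. 0 < n \<Longrightarrow> q ^ n \<le> C * C'\<close>[of "Suc n"] by simp
  qed
  then have "r i powr e \<le> p i"
    using p_bounds[OF i] by (simp add: q_def)
  then have "ln (r i powr e) \<le> ln (p i)"
    using r_bounds[OF i] by (intro ln_mono) auto
  then have "e * ln (r i) \<le> ln (p i)"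
    using r_bounds[OF i] by (simp add: ln_powr)
  then show "ereal (ln (p i) / ln (r i)) \<le> ereal e"
    using r_bounds[OF i] by (simp add: neg_divide_le_eq)
qed

text \<open>The exceptional sets for the countably many \<open>n\<close> are joined into one null
  set, for a letter attaining the maximum.\<close>

lemma AE_pointwise_assouad_dim:
  assumes "open_set_condition \<Lambda> \<phi>" and "doubling_on F \<mu>"
  shows "AE x in \<mu>. ereal max_exponent \<le> pointwise_assouad_dim \<mu> x"
proof -
  obtain i where i: "i \<in> \<Lambda>" "max_exponent = ln (p i) / ln (r i)"
    by (rule max_exponent_attained)
  have "AE x in \<mu>. \<forall>n. \<exists>u\<in>lists \<Lambda>. x \<in> foldr \<phi> (u @ replicate n i) ` F"
    using AE_code_contains_power[OF i(1)] by (simp add: AE_all_countable)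
  then show ?thesis
    using exponent_le_pointwise_assouad_dim[OF assms i(1)] i(2) by (auto elim!: eventually_mono)
qed

lemma assouad_dim_eq_max_exponent:
  assumes "open_set_condition \<Lambda> \<phi>" and "doubling_on F \<mu>"
  shows "assouad_dim F \<mu> = ereal max_exponent"
    and "AE x in \<mu>. x \<in> F \<longrightarrow> pointwise_assouad_dim \<mu> x = assouad_dim F \<mu>"
proof -
  note AE = AE_pointwise_assouad_dim[OF assms]
  have "AE x in \<mu>. x \<in> F"
    using measure_superset_F[OF subset_refl F_borel] F_borel by (subst prob_eq_1[symmetric]) auto
  with AE have "AE x in \<mu>. ereal max_exponent \<le> assouad_dim F \<mu>"
    by eventually_elim (metis order_trans pointwise_assouad_dim_le)
  \<comment> \<open>The inequality no longer mentions the point, and in a probability space an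
    almost sure constant statement is true.\<close>
  then have "ereal max_exponent \<le> assouad_dim F \<mu>"
    by simp
  then show eq: "assouad_dim F \<mu> = ereal max_exponent"
    using assouad_dim_le_max_exponent[OF assms] by simp
  show "AE x in \<mu>. x \<in> F \<longrightarrow> pointwise_assouad_dim \<mu> x = assouad_dim F \<mu>"
    using AE by eventually_elim (metis eq order_antisym pointwise_assouad_dim_le)
qed

end

theorem theorem6p1:
  fixes \<Lambda> :: "'i set"
    and \<phi> :: "'i \<Rightarrow> real ^ 'n \<Rightarrow> real ^ 'n"
    and r p :: "'i \<Rightarrow> real"
    and F :: "(real ^ 'n) set"
    and \<mu> :: "(real ^ 'n) measure"
  assumes "finite \<Lambda>"
    and "\<And>i. i \<in> \<Lambda> \<Longrightarrow> contracting_similarity (\<phi> i) (r i)"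
    and "open_set_condition \<Lambda> \<phi>"
    and "is_limit_set \<Lambda> \<phi> F"
    and "\<And>i. i \<in> \<Lambda> \<Longrightarrow> 0 < p i \<and> p i < 1"
    and "(\<Sum>i\<in>\<Lambda>. p i) = 1"
    and "is_self_similar_measure \<Lambda> \<phi> p F \<mu>"
    and "doubling_on F \<mu>"
  shows "assouad_dim F \<mu> = ereal (Max ((\<lambda>i. ln (p i) / ln (r i)) ` \<Lambda>)) \<and>
         (AE x in \<mu>. x \<in> F \<longrightarrow> pointwise_assouad_dim \<mu> x = assouad_dim F \<mu>)"
proof -
  interpret self_similar_system \<Lambda> \<phi> r p F \<mu>
    using assms by unfold_locales
  show ?thesis
    using assouad_dim_eq_max_exponent[OF assms(3,8)] by (simp add: max_exponent_def)
qed

end
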